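(* An element $x$ of a continuous dcpo $D$ is sharp if and only if the filter of Scott open neighbourhoods of $x$ is located in the poset of Scott opens of $D$ (ordered by inclusion).
   Context: Everything is constructive: neither excluded middle nor choice is assumed. A subset $S$ of a poset is directed if it is inhabited and any two elements of $S$ have an upper bound in $S$. A dcpo is a poset $(D,\sqsubseteq)$ in which every directed subset $S$ has a supremum $\bigsqcup S$. In a dcpo (in particular in the poset of Scott opens of $D$ ordered by inclusion), $x\ll y$ ($x$ is way below $y$) means that for every directed $S$ with $y\sqsubseteq\bigsqcup S$ there is $s\in S$ with $x\sqsubseteq s$. $D$ is continuous if for every $x$ the set $\{y\in D\mid y\ll x\}$ is directed with supremum $x$. A subset $U\subseteq D$ is Scott open if it is an upper set and whenever $\bigsqcup S\in U$ with $S$ directed, some $s\in S$ is in $U$. An element $x\in D$ is sharp if for every $y,z\in D$ with $y\ll z$ we have $y\ll x$ or $\lnot(z\sqsubseteq x)$. A subset $V$ of a poset $S$ is located if for every $s,t\in S$ with $s\ll t$, we have $t\in V$ or $s\notin V$. *)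

theory Defs
  imports Main
begin

text \<open>
  The mathematics formalised here is constructive: neither excluded middle nor choice is assumed.
  Over the classical \<^typ>\<open>bool\<close> every element of a dcpo is sharp and every upper set is located, so
  stating these notions with the connectives of HOL would make the result vacuous.
  Instead, every notion is a formula of intuitionistic higher-order logic with truth values in an
  arbitrary complete Heyting algebra (frame) \<open>'h\<close>; the connectives and quantifiers are the
  bold ones below.  A formula holds if its truth value is \<^term>\<open>top\<close>.  Intuitionistic reasoning is
  sound for this reading, excluded middle and choice are not, and \<open>'h = bool\<close> gives back the
  classical reading.
\<close>

section \<open>Intuitionistic truth values\<close>

class complete_heyting_algebra = complete_lattice +
  assumes inf_Sup_distrib: "inf a (Sup B) = Sup (inf a ` B)"

abbreviation hconj :: "'h::complete_heyting_algebra \<Rightarrow> 'h \<Rightarrow> 'h"  (infixr "\<^bold>\<and>" 35)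
  where "p \<^bold>\<and> q \<equiv> inf p q"

abbreviation hdisj :: "'h::complete_heyting_algebra \<Rightarrow> 'h \<Rightarrow> 'h"  (infixr "\<^bold>\<or>" 30)
  where "p \<^bold>\<or> q \<equiv> sup p q"

definition himp :: "'h::complete_heyting_algebra \<Rightarrow> 'h \<Rightarrow> 'h"  (infixr "\<^bold>\<longrightarrow>" 25)
  where "(p \<^bold>\<longrightarrow> q) = Sup {r. inf r p \<le> q}"

abbreviation hiff :: "'h::complete_heyting_algebra \<Rightarrow> 'h \<Rightarrow> 'h"  (infixr "\<^bold>\<longleftrightarrow>" 25)
  where "p \<^bold>\<longleftrightarrow> q \<equiv> (p \<^bold>\<longrightarrow> q) \<^bold>\<and> (q \<^bold>\<longrightarrow> p)"

abbreviation hneg :: "'h::complete_heyting_algebra \<Rightarrow> 'h"  ("\<^bold>\<not> _" [40] 40)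
  where "\<^bold>\<not> p \<equiv> p \<^bold>\<longrightarrow> bot"

abbreviation hAll :: "('a \<Rightarrow> 'h::complete_heyting_algebra) \<Rightarrow> 'h"  (binder "\<^bold>\<forall>" 10)
  where "hAll P \<equiv> Inf (range P)"

abbreviation hEx :: "('a \<Rightarrow> 'h::complete_heyting_algebra) \<Rightarrow> 'h"  (binder "\<^bold>\<exists>" 10)
  where "hEx P \<equiv> Sup (range P)"

definition holds :: "'h::complete_heyting_algebra \<Rightarrow> bool"  ("\<Turnstile> _" [5] 5)
  where "(\<Turnstile> p) \<longleftrightarrow> p = top"

lemma le_himp_iff: "r \<le> (p \<^bold>\<longrightarrow> q) \<longleftrightarrow> (r \<^bold>\<and> p) \<le> q"
proof
  assume "r \<le> (p \<^bold>\<longrightarrow> q)"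
  then have "inf r p \<le> inf p (Sup {r. inf r p \<le> q})"
    by (simp add: himp_def inf.commute le_infI2)
  also have "\<dots> \<le> q"
    unfolding inf_Sup_distrib by (rule Sup_least) (auto simp: inf.commute)
  finally show "inf r p \<le> q" .
qed (auto simp: himp_def intro: Sup_upper)

lemma holds_himp_iff: "(\<Turnstile> p \<^bold>\<longrightarrow> q) \<longleftrightarrow> p \<le> q"
  using le_himp_iff[of top p q] by (simp add: holds_def top_le inf.commute top_unique)

instance bool :: complete_heyting_algebra
  by standard auto

lemma himp_bool: "((p::bool) \<^bold>\<longrightarrow> q) \<longleftrightarrow> (p \<longrightarrow> q)"
  by (auto simp: himp_def)


section \<open>Sets, subsets and posets\<close>

text \<open>
  A set is given by a type of names and an equality with truth values in \<open>'h\<close>; the truth value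
  of \<open>equ P x x\<close> is the extent to which \<open>x\<close> names an element at all, so quantification over the set
  is quantification over names relativised to \<open>carr P\<close>.  The carrier may depend on the truth-value
  algebra; all predicates are required to respect equality.
\<close>

record ('a, 'h) hposet =
  equ :: "'a \<Rightarrow> 'a \<Rightarrow> 'h"
  leq :: "'a \<Rightarrow> 'a \<Rightarrow> 'h"

definition carr :: "('a, 'h::complete_heyting_algebra) hposet \<Rightarrow> 'a \<Rightarrow> 'h" where
  "carr P x = equ P x x"

definition poset :: "('a, 'h::complete_heyting_algebra) hposet \<Rightarrow> 'h" where
  "poset P =
    ((\<^bold>\<forall>x y. equ P x y \<^bold>\<longrightarrow> equ P y x) \<^bold>\<and>
     (\<^bold>\<forall>x y z. equ P x y \<^bold>\<and> equ P y z \<^bold>\<longrightarrow> equ P x z) \<^bold>\<and>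
     (\<^bold>\<forall>x y. leq P x y \<^bold>\<longrightarrow> carr P x \<^bold>\<and> carr P y) \<^bold>\<and>
     (\<^bold>\<forall>x x' y y'. equ P x x' \<^bold>\<and> equ P y y' \<^bold>\<and> leq P x y \<^bold>\<longrightarrow> leq P x' y') \<^bold>\<and>
     (\<^bold>\<forall>x. carr P x \<^bold>\<longrightarrow> leq P x x) \<^bold>\<and>
     (\<^bold>\<forall>x y z. leq P x y \<^bold>\<and> leq P y z \<^bold>\<longrightarrow> leq P x z) \<^bold>\<and>
     (\<^bold>\<forall>x y. leq P x y \<^bold>\<and> leq P y x \<^bold>\<longrightarrow> equ P x y))"

definition subset_of :: "('a, 'h::complete_heyting_algebra) hposet \<Rightarrow> ('a \<Rightarrow> 'h) \<Rightarrow> 'h" where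
  "subset_of P S =
    ((\<^bold>\<forall>x. S x \<^bold>\<longrightarrow> carr P x) \<^bold>\<and> (\<^bold>\<forall>x y. S x \<^bold>\<and> equ P x y \<^bold>\<longrightarrow> S y))"

definition directed :: "('a, 'h::complete_heyting_algebra) hposet \<Rightarrow> ('a \<Rightarrow> 'h) \<Rightarrow> 'h" where
  "directed P S =
    (subset_of P S \<^bold>\<and> (\<^bold>\<exists>x. S x) \<^bold>\<and>
     (\<^bold>\<forall>x y. S x \<^bold>\<and> S y \<^bold>\<longrightarrow> (\<^bold>\<exists>z. S z \<^bold>\<and> leq P x z \<^bold>\<and> leq P y z)))"

definition is_upper_bound ::
    "('a, 'h::complete_heyting_algebra) hposet \<Rightarrow> ('a \<Rightarrow> 'h) \<Rightarrow> 'a \<Rightarrow> 'h" where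
  "is_upper_bound P S u = (carr P u \<^bold>\<and> (\<^bold>\<forall>s. S s \<^bold>\<longrightarrow> leq P s u))"

definition is_supremum ::
    "('a, 'h::complete_heyting_algebra) hposet \<Rightarrow> ('a \<Rightarrow> 'h) \<Rightarrow> 'a \<Rightarrow> 'h" where
  "is_supremum P S u =
    (is_upper_bound P S u \<^bold>\<and> (\<^bold>\<forall>v. is_upper_bound P S v \<^bold>\<longrightarrow> leq P u v))"


section \<open>Continuous dcpos, the Scott topology, sharp elements and located subsets\<close>

definition dcpo :: "('a, 'h::complete_heyting_algebra) hposet \<Rightarrow> 'h" where
  "dcpo P = (poset P \<^bold>\<and> (\<^bold>\<forall>S. directed P S \<^bold>\<longrightarrow> (\<^bold>\<exists>u. is_supremum P S u)))"

text \<open>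
  Suprema are unique, so a property of the supremum of a directed \<open>S\<close> is expressed below by
  quantifying over every \<open>u\<close> that is a supremum of \<open>S\<close>.
\<close>

definition way_below ::
    "('a, 'h::complete_heyting_algebra) hposet \<Rightarrow> 'a \<Rightarrow> 'a \<Rightarrow> 'h" where
  "way_below P x y =
    (carr P x \<^bold>\<and> carr P y \<^bold>\<and>
     (\<^bold>\<forall>S u. directed P S \<^bold>\<and> is_supremum P S u \<^bold>\<and> leq P y u \<^bold>\<longrightarrow> (\<^bold>\<exists>s. S s \<^bold>\<and> leq P x s)))"

definition continuous_dcpo :: "('a, 'h::complete_heyting_algebra) hposet \<Rightarrow> 'h" where
  "continuous_dcpo D =
    (dcpo D \<^bold>\<and>
     (\<^bold>\<forall>x. carr D x \<^bold>\<longrightarrow>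
        directed D (\<lambda>y. way_below D y x) \<^bold>\<and> is_supremum D (\<lambda>y. way_below D y x) x))"

definition scott_open :: "('a, 'h::complete_heyting_algebra) hposet \<Rightarrow> ('a \<Rightarrow> 'h) \<Rightarrow> 'h" where
  "scott_open D U =
    (subset_of D U \<^bold>\<and>
     (\<^bold>\<forall>x y. U x \<^bold>\<and> leq D x y \<^bold>\<longrightarrow> U y) \<^bold>\<and>
     (\<^bold>\<forall>S u. directed D S \<^bold>\<and> is_supremum D S u \<^bold>\<and> U u \<^bold>\<longrightarrow> (\<^bold>\<exists>s. S s \<^bold>\<and> U s)))"

definition scott_opens ::
    "('a, 'h::complete_heyting_algebra) hposet \<Rightarrow> ('a \<Rightarrow> 'h, 'h) hposet" where
  "scott_opens D =
    \<lparr> equ = (\<lambda>U V. scott_open D U \<^bold>\<and> scott_open D V \<^bold>\<and> (\<^bold>\<forall>x. U x \<^bold>\<longleftrightarrow> V x)),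
      leq = (\<lambda>U V. scott_open D U \<^bold>\<and> scott_open D V \<^bold>\<and> (\<^bold>\<forall>x. U x \<^bold>\<longrightarrow> V x)) \<rparr>"

definition open_nbhds ::
    "('a, 'h::complete_heyting_algebra) hposet \<Rightarrow> 'a \<Rightarrow> ('a \<Rightarrow> 'h) \<Rightarrow> 'h" where
  "open_nbhds D x = (\<lambda>U. scott_open D U \<^bold>\<and> U x)"

definition sharp :: "('a, 'h::complete_heyting_algebra) hposet \<Rightarrow> 'a \<Rightarrow> 'h" where
  "sharp D x = (\<^bold>\<forall>y z. way_below D y z \<^bold>\<longrightarrow> way_below D y x \<^bold>\<or> \<^bold>\<not> leq D z x)"

definition located :: "('a, 'h::complete_heyting_algebra) hposet \<Rightarrow> ('a \<Rightarrow> 'h) \<Rightarrow> 'h" where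
  "located P V = (\<^bold>\<forall>s t. way_below P s t \<^bold>\<longrightarrow> V t \<^bold>\<or> \<^bold>\<not> V s)"

end

theory Submission
  imports Defs
begin

text \<open>
  If \<open>x\<close> is sharp and \<open>V\<close> is Scott open, then the Scott opens \<open>W \<subseteq> V\<close> such that \<open>x \<in> V\<close> or
  \<open>x \<notin> W\<close> form a directed family, since they contain the empty set and are closed under binary
  unions.  Given \<open>z \<in> V\<close>, pick \<open>y \<ll> z\<close> in \<open>V\<close>; sharpness gives \<open>y \<ll> x\<close>, so that \<open>x \<in> V\<close>, or
  not \<open>z \<sqsubseteq> x\<close>, so that \<open>x\<close> is not way above \<open>z\<close>.  Hence the family contains the set of
  elements way above \<open>z\<close>, and its supremum is \<open>V\<close>.  If \<open>U \<ll> V\<close>, some member therefore contains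
  \<open>U\<close>, which decides \<open>x \<in> V\<close> or \<open>x \<notin> U\<close>.  This avoids finite unions of basic opens.

  Conversely, interpolate \<open>y \<ll> w \<ll> z\<close>.  The set of elements way above \<open>w\<close> is way below the set
  of elements way above \<open>y\<close>, because any Scott open containing \<open>w\<close> contains the former.
  Locatedness gives \<open>y \<ll> x\<close> or not \<open>w \<ll> x\<close>, and the latter excludes \<open>z \<sqsubseteq> x\<close>.
\<close>

section \<open>Forcing\<close>

text \<open>
  Intuitionistic arguments are carried out by reading \<open>c \<le> p\<close> as: the stage \<open>c\<close> forces \<open>p\<close>.
  Introducing an implication or eliminating a disjunction or an existential passes to a smaller
  stage, to which all facts already forced are transported by transitivity.
\<close>

lemma forces_himp_iff:
  "c \<le> (p \<^bold>\<longrightarrow> q) \<longleftrightarrow> (\<forall>d\<le>c. d \<le> p \<longrightarrow> d \<le> q)"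
  for c :: "'h::complete_heyting_algebra"
  unfolding le_himp_iff by (meson inf.cobounded1 inf.cobounded2 inf.boundedI order.trans)

lemma forces_hAll_iff: "c \<le> (\<^bold>\<forall>x. P x) \<longleftrightarrow> (\<forall>x. c \<le> P x)"
  for c :: "'h::complete_heyting_algebra"
  by (auto simp: le_Inf_iff)

lemma forces_mp: "c \<le> (p \<^bold>\<longrightarrow> q) \<Longrightarrow> c \<le> p \<Longrightarrow> c \<le> q"
  for c :: "'h::complete_heyting_algebra"
  by (simp add: forces_himp_iff)

lemma forces_hExI: "c \<le> P x \<Longrightarrow> c \<le> (\<^bold>\<exists>x. P x)"
  for c :: "'h::complete_heyting_algebra"
  by (meson Sup_upper order.trans rangeI)

text \<open>A stage forcing an existential need not force any single instance. By distributivity it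
  is the join of the stages \<open>inf c (P x)\<close>, each of which has its own witness; hence it
  suffices to reach \<open>q\<close> from every such stage.\<close>

lemma forces_hExE:
  fixes c :: "'h::complete_heyting_algebra"
  assumes "c \<le> (\<^bold>\<exists>x. P x)" and "\<And>d x. d \<le> c \<Longrightarrow> d \<le> P x \<Longrightarrow> d \<le> q"
  shows "c \<le> q"
proof -
  have "c = inf c (\<^bold>\<exists>x. P x)" using assms(1) by (simp add: inf.absorb1)
  also have "\<dots> = Sup (inf c ` range P)" by (rule inf_Sup_distrib)
  also have "\<dots> \<le> q"
    by (rule Sup_least) (auto intro: assms(2)[OF inf.cobounded1 inf.cobounded2])
  finally show ?thesis .
qed

text \<open>A binary disjunction is an existential over \<open>bool\<close>, so this reduces to the
  previous rule.\<close>

lemma forces_hdisjE: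
  fixes c :: "'h::complete_heyting_algebra"
  assumes "c \<le> (p \<^bold>\<or> q)"
    and "\<And>d. d \<le> c \<Longrightarrow> d \<le> p \<Longrightarrow> d \<le> r" and "\<And>d. d \<le> c \<Longrightarrow> d \<le> q \<Longrightarrow> d \<le> r"
  shows "c \<le> r"
proof -
  have "c \<le> (\<^bold>\<exists>b. if b then p else q)"
    using assms(1) by (simp add: UNIV_bool sup.commute)
  then show ?thesis
    by (rule forces_hExE) (use assms(2,3) in \<open>auto split: if_splits\<close>)
qed

lemmas forces_iff = forces_himp_iff forces_hAll_iff le_inf_iff

section \<open>Continuous dcpos\<close>

lemma leq_carr:
  assumes P: "c \<le> poset P" and l: "c \<le> leq P x y"
  shows "c \<le> carr P x" "c \<le> carr P y"
proof -
  have "c \<le> (leq P x y \<^bold>\<longrightarrow> carr P x \<^bold>\<and> carr P y)"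
    using P unfolding poset_def le_inf_iff forces_hAll_iff by blast
  from forces_mp[OF this l] show "c \<le> carr P x" "c \<le> carr P y" by simp_all
qed

lemma leq_refl:
  assumes P: "c \<le> poset P" and x: "c \<le> carr P x"
  shows "c \<le> leq P x x"
proof -
  have "c \<le> (carr P x \<^bold>\<longrightarrow> leq P x x)"
    using P unfolding poset_def le_inf_iff forces_hAll_iff by blast
  then show ?thesis using x by (rule forces_mp)
qed

lemma leq_trans:
  assumes P: "c \<le> poset P" and "c \<le> leq P x y" "c \<le> leq P y z"
  shows "c \<le> leq P x z"
proof -
  have "c \<le> (leq P x y \<^bold>\<and> leq P y z \<^bold>\<longrightarrow> leq P x z)"
    using P unfolding poset_def le_inf_iff forces_hAll_iff by simp
  then show ?thesis by (rule forces_mp) (simp add: assms)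
qed

lemma equ_sym:
  assumes P: "c \<le> poset P" and "c \<le> equ P x y"
  shows "c \<le> equ P y x"
proof -
  have "c \<le> (equ P x y \<^bold>\<longrightarrow> equ P y x)"
    using P unfolding poset_def le_inf_iff forces_hAll_iff by simp
  then show ?thesis by (rule forces_mp) (simp add: assms)
qed

lemma equ_trans:
  assumes P: "c \<le> poset P" and "c \<le> equ P x y" "c \<le> equ P y z"
  shows "c \<le> equ P x z"
proof -
  have "c \<le> (equ P x y \<^bold>\<and> equ P y z \<^bold>\<longrightarrow> equ P x z)"
    using P unfolding poset_def le_inf_iff forces_hAll_iff by simp
  then show ?thesis by (rule forces_mp) (simp add: assms)
qed

text \<open>Symmetry and transitivity show that \<open>x\<close> exists at stage \<open>c\<close>,
  so \<open>leq P x x\<close> is forced there; replacing the right-hand \<open>x\<close> by its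
  equal \<open>y\<close> gives the claim.\<close>

lemma equ_leq:
  assumes P: "c \<le> poset P" and e: "c \<le> equ P x y"
  shows "c \<le> leq P x y"
proof -
  have x: "c \<le> equ P x x" using equ_trans[OF P e equ_sym[OF P e]] .
  then have "c \<le> leq P x x" using leq_refl[OF P] by (simp add: carr_def)
  have "c \<le> (equ P x x \<^bold>\<and> equ P x y \<^bold>\<and> leq P x x \<^bold>\<longrightarrow> leq P x y)"
    using P unfolding poset_def le_inf_iff forces_hAll_iff by blast
  then show ?thesis by (rule forces_mp) (intro le_infI x e \<open>c \<le> leq P x x\<close>)
qed

section \<open>Introduction and elimination rules for way below, suprema and directedness\<close>

lemma way_belowI:
  assumes "c \<le> carr P x" "c \<le> carr P y"
    and "\<And>d S u. \<lbrakk>d \<le> c; d \<le> directed P S; d \<le> is_supremum P S u; d \<le> leq P y u\<rbrakk>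
      \<Longrightarrow> d \<le> (\<^bold>\<exists>s. S s \<^bold>\<and> leq P x s)"
  shows "c \<le> way_below P x y"
  using assms unfolding way_below_def by (auto simp: forces_iff)

lemma way_below_carr:
  assumes "c \<le> way_below P x y"
  shows "c \<le> carr P x" "c \<le> carr P y"
  using assms unfolding way_below_def by simp_all

lemma way_belowD:
  assumes "c \<le> way_below P x y" "c \<le> directed P S" "c \<le> is_supremum P S u" "c \<le> leq P y u"
  shows "c \<le> (\<^bold>\<exists>s. S s \<^bold>\<and> leq P x s)"
  using assms unfolding way_below_def by (simp add: forces_iff)

lemma is_supremum_upper: "c \<le> is_supremum P S u \<Longrightarrow> c \<le> S s \<Longrightarrow> c \<le> leq P s u"
  unfolding is_supremum_def is_upper_bound_def by (simp add: forces_iff)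

lemma is_supremum_least:
  assumes "c \<le> is_supremum P S u" "c \<le> carr P v" "\<And>d s. d \<le> c \<Longrightarrow> d \<le> S s \<Longrightarrow> d \<le> leq P s v"
  shows "c \<le> leq P u v"
  using assms unfolding is_supremum_def is_upper_bound_def by (auto simp: forces_iff)

lemma is_supremumI:
  assumes "c \<le> carr P u" "\<And>d s. d \<le> c \<Longrightarrow> d \<le> S s \<Longrightarrow> d \<le> leq P s u"
    and "\<And>d v. \<lbrakk>d \<le> c; d \<le> carr P v; \<And>e s. e \<le> d \<Longrightarrow> e \<le> S s \<Longrightarrow> e \<le> leq P s v\<rbrakk>
      \<Longrightarrow> d \<le> leq P u v"
  shows "c \<le> is_supremum P S u"
  using assms unfolding is_supremum_def is_upper_bound_def by (auto simp: forces_iff)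

lemma subset_ofI:
  assumes "\<And>d x. d \<le> c \<Longrightarrow> d \<le> S x \<Longrightarrow> d \<le> carr P x"
    and "\<And>d x y. d \<le> c \<Longrightarrow> d \<le> S x \<Longrightarrow> d \<le> equ P x y \<Longrightarrow> d \<le> S y"
  shows "c \<le> subset_of P S"
  using assms unfolding subset_of_def by (auto simp: forces_iff)

lemma subset_of_carr: "c \<le> subset_of P S \<Longrightarrow> c \<le> S x \<Longrightarrow> c \<le> carr P x"
  unfolding subset_of_def by (simp add: forces_iff)

lemma directedI:
  assumes "c \<le> subset_of P S" "c \<le> (\<^bold>\<exists>x. S x)"
    and "\<And>d x y. d \<le> c \<Longrightarrow> d \<le> S x \<Longrightarrow> d \<le> S y
      \<Longrightarrow> d \<le> (\<^bold>\<exists>z. S z \<^bold>\<and> leq P x z \<^bold>\<and> leq P y z)"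
  shows "c \<le> directed P S"
  using assms unfolding directed_def by (auto simp: forces_iff)

lemma directed_subset: "c \<le> directed P S \<Longrightarrow> c \<le> subset_of P S"
  unfolding directed_def by simp

lemma directed_inhabited: "c \<le> directed P S \<Longrightarrow> c \<le> (\<^bold>\<exists>x. S x)"
  unfolding directed_def by simp

lemma directed_upper:
  "c \<le> directed P S \<Longrightarrow> c \<le> S x \<Longrightarrow> c \<le> S y \<Longrightarrow> c \<le> (\<^bold>\<exists>z. S z \<^bold>\<and> leq P x z \<^bold>\<and> leq P y z)"
  unfolding directed_def by (simp add: forces_iff)

section \<open>The way-below relation and its interpolation property\<close>

lemma way_below_mono:
  assumes P: "c \<le> poset P" and "c \<le> leq P x' x" "c \<le> way_below P x y" "c \<le> leq P y y'"
  shows "c \<le> way_below P x' y'"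
proof (rule way_belowI)
  show "c \<le> carr P x'" "c \<le> carr P y'"
    using leq_carr(1)[OF P assms(2)] leq_carr(2)[OF P assms(4)] .
  fix d S u
  assume d: "d \<le> c" and S: "d \<le> directed P S" "d \<le> is_supremum P S u" and "d \<le> leq P y' u"
  note up = order.trans[OF d]
  have "d \<le> leq P y u" using leq_trans[OF up[OF P] up[OF assms(4)] \<open>d \<le> leq P y' u\<close>] .
  with S have "d \<le> (\<^bold>\<exists>s. S s \<^bold>\<and> leq P x s)" by (rule way_belowD[OF up[OF assms(3)]])
  then show "d \<le> (\<^bold>\<exists>s. S s \<^bold>\<and> leq P x' s)"
  proof (rule forces_hExE)
    fix e s assume e: "e \<le> d" and s: "e \<le> (S s \<^bold>\<and> leq P x s)"
    have "e \<le> leq P x s" using s by simp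
    then have "e \<le> leq P x' s" by (rule leq_trans[OF order.trans[OF e up[OF P]] order.trans[OF e up[OF assms(2)]]])
    with s show "e \<le> (\<^bold>\<exists>s. S s \<^bold>\<and> leq P x' s)" by (intro forces_hExI[of _ _ s]) simp
  qed
qed

lemma continuous_dcpo_poset: "c \<le> continuous_dcpo D \<Longrightarrow> c \<le> poset D"
  unfolding continuous_dcpo_def dcpo_def by simp

lemma directed_way_below:
  "c \<le> continuous_dcpo D \<Longrightarrow> c \<le> carr D x \<Longrightarrow> c \<le> directed D (\<lambda>y. way_below D y x)"
  unfolding continuous_dcpo_def by (simp add: forces_iff)

lemma is_supremum_way_below:
  "c \<le> continuous_dcpo D \<Longrightarrow> c \<le> carr D x \<Longrightarrow> c \<le> is_supremum D (\<lambda>y. way_below D y x) x"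
  unfolding continuous_dcpo_def by (simp add: forces_iff)

lemma way_below_leq:
  "c \<le> continuous_dcpo D \<Longrightarrow> c \<le> way_below D x y \<Longrightarrow> c \<le> leq D x y"
  by (rule is_supremum_upper[OF is_supremum_way_below[OF _ way_below_carr(2)]])

lemma way_below_leq_trans:
  assumes "c \<le> continuous_dcpo D" "c \<le> way_below D x y" "c \<le> leq D y z"
  shows "c \<le> way_below D x z"
  using way_below_mono[OF _ leq_refl[OF _ way_below_carr(1)[OF assms(2)]] assms(2,3)]
    continuous_dcpo_poset[OF assms(1)] by blast

lemma leq_way_below_trans:
  assumes "c \<le> continuous_dcpo D" "c \<le> leq D x y" "c \<le> way_below D y z"
  shows "c \<le> way_below D x z"
  using way_below_mono[OF _ assms(2,3) leq_refl[OF _ way_below_carr(2)[OF assms(3)]]]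
    continuous_dcpo_poset[OF assms(1)] by blast

text \<open>The elements reached from \<open>z\<close> by two way-below steps down form a directed
  set with supremum \<open>z\<close>. Since \<open>x \<ll> z\<close>, one of them lies above
  \<open>x\<close>, and its intermediate element interpolates.\<close>

lemma way_below_interpolate:
  assumes D: "c \<le> continuous_dcpo D" and xz: "c \<le> way_below D x z"
  shows "c \<le> (\<^bold>\<exists>y. way_below D x y \<^bold>\<and> way_below D y z)"
proof -
  define S where "S w = (\<^bold>\<exists>y. way_below D w y \<^bold>\<and> way_below D y z)" for w
  have SI: "e \<le> S w" if "e \<le> way_below D w y" "e \<le> way_below D y z" for e w y
    unfolding S_def by (rule forces_hExI[of _ _ y]) (simp add: that)
  have SE: "e \<le> q" if "e \<le> S w"
    "\<And>f y. f \<le> e \<Longrightarrow> f \<le> way_below D w y \<Longrightarrow> f \<le> way_below D y z \<Longrightarrow> f \<le> q" for e w q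
    by (rule forces_hExE[OF that(1)[unfolded S_def]]) (use that(2) in auto)
  have z: "c \<le> carr D z" using xz by (rule way_below_carr)
  have sub: "c \<le> subset_of D S"
  proof (rule subset_ofI)
    show "d \<le> carr D w" if "d \<le> c" "d \<le> S w" for d w
      by (rule SE[OF that(2)]) (erule way_below_carr(1))
  next
    fix d w w' assume d: "d \<le> c" and w: "d \<le> S w" and e: "d \<le> equ D w w'"
    have D': "d \<le> continuous_dcpo D" using D d by simp
    \<comment> \<open>Transport along equality only needs \<open>w' \<sqsubseteq> w\<close>, since
      the way-below relation is closed downwards on the left.\<close>
    have l: "d \<le> leq D w' w"
      using equ_leq[OF _ equ_sym[OF _ e]] continuous_dcpo_poset[OF D'] by blast
    show "d \<le> S w'"
    proof (rule SE[OF w])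
      fix f y assume f: "f \<le> d" and y: "f \<le> way_below D w y" "f \<le> way_below D y z"
      show "f \<le> S w'"
        using SI[OF leq_way_below_trans[OF order.trans[OF f D'] order.trans[OF f l] y(1)] y(2)] .
    qed
  qed
  have inh: "c \<le> (\<^bold>\<exists>w. S w)"
  proof (rule forces_hExE[OF directed_inhabited[OF directed_way_below[OF D z]]])
    fix d y assume d: "d \<le> c" and y: "d \<le> way_below D y z"
    have D': "d \<le> continuous_dcpo D" using D d by simp
    show "d \<le> (\<^bold>\<exists>w. S w)"
    proof (rule forces_hExE[OF directed_inhabited[OF directed_way_below[OF D' way_below_carr(1)[OF y]]]])
      fix e w assume e: "e \<le> d" and w: "e \<le> way_below D w y"
      show "e \<le> (\<^bold>\<exists>w. S w)" using SI[OF w order.trans[OF e y]] by (rule forces_hExI)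
    qed
  qed
  have "c \<le> directed D S"
  proof (rule directedI[OF sub inh])
    fix d w1 w2 assume d: "d \<le> c" and w1: "d \<le> S w1" and w2: "d \<le> S w2"
    let ?g = "\<^bold>\<exists>w. S w \<^bold>\<and> leq D w1 w \<^bold>\<and> leq D w2 w"
    show "d \<le> ?g"
    proof (rule SE[OF w1])
      fix e y1 assume e: "e \<le> d" and y1: "e \<le> way_below D w1 y1" "e \<le> way_below D y1 z"
      show "e \<le> ?g"
      proof (rule SE[OF order.trans[OF e w2]])
        fix f y2 assume f: "f \<le> e" and y2: "f \<le> way_below D w2 y2" "f \<le> way_below D y2 z"
        have Df: "f \<le> continuous_dcpo D" and zf: "f \<le> carr D z" using D z d e f by simp_all
        have y1f: "f \<le> way_below D w1 y1" "f \<le> way_below D y1 z" using y1 f by simp_all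
        show "f \<le> ?g"
        \<comment> \<open>First bound the intermediate elements: some \<open>y3 \<ll> z\<close> lies
          above \<open>y1\<close> and \<open>y2\<close>. Then \<open>w1\<close> and
          \<open>w2\<close> are both way below \<open>y3\<close>, and directedness can be used a
          second time, below \<open>y3\<close>.\<close>
        proof (rule forces_hExE[OF directed_upper[OF directed_way_below[OF Df zf] y1f(2) y2(2)]])
          fix g y3 assume g: "g \<le> f"
            and "g \<le> (way_below D y3 z \<^bold>\<and> leq D y1 y3 \<^bold>\<and> leq D y2 y3)"
          then have y3: "g \<le> way_below D y3 z" "g \<le> leq D y1 y3" "g \<le> leq D y2 y3" by simp_all
          have Dg: "g \<le> continuous_dcpo D" using Df g by simp
          have ww: "g \<le> way_below D w1 y3" "g \<le> way_below D w2 y3"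
            using way_below_leq_trans[OF Dg order.trans[OF g y1f(1)] y3(2)]
              way_below_leq_trans[OF Dg order.trans[OF g y2(1)] y3(3)] .
          show "g \<le> ?g"
          proof (rule forces_hExE[OF directed_upper[OF directed_way_below[OF Dg way_below_carr(1)[OF y3(1)]] ww]])
            fix h w assume h: "h \<le> g"
              and w: "h \<le> (way_below D w y3 \<^bold>\<and> leq D w1 w \<^bold>\<and> leq D w2 w)"
            then have "h \<le> way_below D w y3" by simp
            then have "h \<le> S w" by (rule SI[OF _ order.trans[OF h y3(1)]])
            with w show "h \<le> ?g" by (intro forces_hExI[of _ _ w]) simp
          qed
        qed
      qed
    qed
  qed
  moreover have "c \<le> is_supremum D S z"
  proof (rule is_supremumI[OF z])
    fix d w assume d: "d \<le> c" and w: "d \<le> S w"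
    show "d \<le> leq D w z"
    proof (rule SE[OF w])
      fix e y assume e: "e \<le> d" and y: "e \<le> way_below D w y" "e \<le> way_below D y z"
      have De: "e \<le> continuous_dcpo D" using D d e by simp
      show "e \<le> leq D w z"
        using leq_trans[OF continuous_dcpo_poset[OF De] way_below_leq[OF De y(1)] way_below_leq[OF De y(2)]] .
    qed
  next
    fix d v assume d: "d \<le> c" and v: "d \<le> carr D v"
      and ub: "\<And>e s. e \<le> d \<Longrightarrow> e \<le> S s \<Longrightarrow> e \<le> leq D s v"
    have Dd: "d \<le> continuous_dcpo D" and zd: "d \<le> carr D z" using D z d by simp_all
    show "d \<le> leq D z v"
    \<comment> \<open>Continuity is used twice: \<open>z\<close> is the supremum of all
      \<open>y \<ll> z\<close>, and each such \<open>y\<close> is the supremum of all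
      \<open>w \<ll> y\<close>, which are members of \<open>S\<close>.\<close>
    proof (rule is_supremum_least[OF is_supremum_way_below[OF Dd zd] v])
      fix e y assume e: "e \<le> d" and y: "e \<le> way_below D y z"
      have De: "e \<le> continuous_dcpo D" and ve: "e \<le> carr D v" using Dd v e by simp_all
      show "e \<le> leq D y v"
      proof (rule is_supremum_least[OF is_supremum_way_below[OF De way_below_carr(1)[OF y]] ve])
        fix f w assume f: "f \<le> e" and w: "f \<le> way_below D w y"
        have "f \<le> S w" using SI[OF w order.trans[OF f y]] .
        then show "f \<le> leq D w v" by (rule ub[OF order.trans[OF f e]])
      qed
    qed
  qed
  moreover have "c \<le> leq D z z" using leq_refl[OF continuous_dcpo_poset[OF D] z] .
  ultimately have "c \<le> (\<^bold>\<exists>w. S w \<^bold>\<and> leq D x w)" by (rule way_belowD[OF xz])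
  then show ?thesis (is "_ \<le> ?g")
  proof (rule forces_hExE)
    fix d w assume d: "d \<le> c" and "d \<le> (S w \<^bold>\<and> leq D x w)"
    then have w: "d \<le> S w" "d \<le> leq D x w" by simp_all
    show "d \<le> ?g"
    proof (rule SE[OF w(1)])
      fix e y assume e: "e \<le> d" and y: "e \<le> way_below D w y" "e \<le> way_below D y z"
      have "e \<le> way_below D x y"
        using leq_way_below_trans[OF order.trans[OF e order.trans[OF d D]] order.trans[OF e w(2)] y(1)] .
      with y(2) show "e \<le> ?g" by (intro forces_hExI[of _ _ y]) simp
    qed
  qed
qed

section \<open>Scott opens\<close>

text \<open>Respect for equality comes from upward closure, because equal elements are below each
  other.\<close>

lemma scott_openI:
  assumes "c \<le> poset D" "\<And>d x. d \<le> c \<Longrightarrow> d \<le> U x \<Longrightarrow> d \<le> carr D x"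
    and "\<And>d x y. d \<le> c \<Longrightarrow> d \<le> U x \<Longrightarrow> d \<le> leq D x y \<Longrightarrow> d \<le> U y"
    and "\<And>d S u. \<lbrakk>d \<le> c; d \<le> directed D S; d \<le> is_supremum D S u; d \<le> U u\<rbrakk>
      \<Longrightarrow> d \<le> (\<^bold>\<exists>s. S s \<^bold>\<and> U s)"
  shows "c \<le> scott_open D U"
proof -
  have "c \<le> subset_of D U"
  proof (rule subset_ofI)
    fix d x y assume d: "d \<le> c" and x: "d \<le> U x" and e: "d \<le> equ D x y"
    show "d \<le> U y" using assms(3)[OF d x equ_leq[OF order.trans[OF d assms(1)] e]] .
  qed (rule assms(2))
  then show ?thesis unfolding scott_open_def using assms(3,4) by (auto simp: forces_iff)
qed

lemma scott_open_carr: "c \<le> scott_open D U \<Longrightarrow> c \<le> U x \<Longrightarrow> c \<le> carr D x"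
  unfolding scott_open_def le_inf_iff using subset_of_carr[of c D U x] by blast

lemma scott_open_upper:
  assumes U: "c \<le> scott_open D U" and "c \<le> U x" "c \<le> leq D x y"
  shows "c \<le> U y"
proof -
  have "c \<le> (U x \<^bold>\<and> leq D x y \<^bold>\<longrightarrow> U y)"
    using U unfolding scott_open_def le_inf_iff forces_hAll_iff by simp
  then show ?thesis by (rule forces_mp) (simp add: assms)
qed

lemma scott_open_directed:
  assumes U: "c \<le> scott_open D U" and "c \<le> directed D S" "c \<le> is_supremum D S u" "c \<le> U u"
  shows "c \<le> (\<^bold>\<exists>s. S s \<^bold>\<and> U s)"
proof -
  have "c \<le> (directed D S \<^bold>\<and> is_supremum D S u \<^bold>\<and> U u \<^bold>\<longrightarrow> (\<^bold>\<exists>s. S s \<^bold>\<and> U s))"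
    using U unfolding scott_open_def le_inf_iff forces_hAll_iff by blast
  then show ?thesis by (rule forces_mp) (simp add: assms)
qed

text \<open>Interpolation makes the set of elements way above \<open>y\<close> inaccessible by
  directed suprema: if \<open>y \<ll> w \<ll> u\<close> and \<open>u\<close> is the supremum of
  \<open>S\<close>, some \<open>s\<close> in \<open>S\<close> lies above \<open>w\<close>, hence way
  above \<open>y\<close>.\<close>

lemma scott_open_way_below:
  assumes D: "c \<le> continuous_dcpo D"
  shows "c \<le> scott_open D (way_below D y)"
proof (rule scott_openI)
  show "c \<le> poset D" using D by (rule continuous_dcpo_poset)
  show "d \<le> carr D x" if "d \<le> way_below D y x" for d x using that by (rule way_below_carr)
  show "d \<le> way_below D y x'" if "d \<le> c" "d \<le> way_below D y x" "d \<le> leq D x x'" for d x x'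
    using way_below_leq_trans[OF order.trans[OF that(1) D] that(2,3)] .
next
  fix d S u
  assume d: "d \<le> c" and S: "d \<le> directed D S" "d \<le> is_supremum D S u" and u: "d \<le> way_below D y u"
  show "d \<le> (\<^bold>\<exists>s. S s \<^bold>\<and> way_below D y s)"
  proof (rule forces_hExE[OF way_below_interpolate[OF order.trans[OF d D] u]])
    fix e w assume e: "e \<le> d" and "e \<le> (way_below D y w \<^bold>\<and> way_below D w u)"
    then have w: "e \<le> way_below D y w" "e \<le> way_below D w u" by simp_all
    have De: "e \<le> continuous_dcpo D" using D d e by simp
    have "e \<le> leq D u u" using leq_refl[OF continuous_dcpo_poset[OF De] way_below_carr(2)[OF w(2)]] .
    then have "e \<le> (\<^bold>\<exists>s. S s \<^bold>\<and> leq D w s)"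
      by (rule way_belowD[OF w(2) order.trans[OF e S(1)] order.trans[OF e S(2)]])
    then show "e \<le> (\<^bold>\<exists>s. S s \<^bold>\<and> way_below D y s)"
    proof (rule forces_hExE)
      fix f s assume f: "f \<le> e" and s: "f \<le> (S s \<^bold>\<and> leq D w s)"
      then have "f \<le> leq D w s" by simp
      then have "f \<le> way_below D y s"
        by (rule way_below_leq_trans[OF order.trans[OF f De] order.trans[OF f w(1)]])
      with s show "f \<le> (\<^bold>\<exists>s. S s \<^bold>\<and> way_below D y s)" by (intro forces_hExI[of _ _ s]) simp
    qed
  qed
qed

section \<open>The empty set and unions of Scott opens\<close>

lemma scott_open_empty: "c \<le> poset D \<Longrightarrow> c \<le> scott_open D (\<lambda>x. bot)"
  by (rule scott_openI) (auto intro: order.trans)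

lemma scott_open_Union:
  assumes P: "c \<le> poset D" and S: "\<And>d U. d \<le> c \<Longrightarrow> d \<le> S U \<Longrightarrow> d \<le> scott_open D U"
  shows "c \<le> scott_open D (\<lambda>x. \<^bold>\<exists>U. S U \<^bold>\<and> U x)"
proof (rule scott_openI[OF P])
  fix d x assume d: "d \<le> c" and x: "d \<le> (\<^bold>\<exists>U. S U \<^bold>\<and> U x)"
  show "d \<le> carr D x"
  proof (rule forces_hExE[OF x])
    fix e U assume e: "e \<le> d" and "e \<le> (S U \<^bold>\<and> U x)"
    then have U: "e \<le> S U" "e \<le> U x" by simp_all
    show "e \<le> carr D x" using scott_open_carr[OF S[OF order.trans[OF e d] U(1)] U(2)] .
  qed
next
  fix d x y assume d: "d \<le> c" and x: "d \<le> (\<^bold>\<exists>U. S U \<^bold>\<and> U x)" and l: "d \<le> leq D x y"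
  show "d \<le> (\<^bold>\<exists>U. S U \<^bold>\<and> U y)"
  proof (rule forces_hExE[OF x])
    fix e U assume e: "e \<le> d" and "e \<le> (S U \<^bold>\<and> U x)"
    then have U: "e \<le> S U" "e \<le> U x" by simp_all
    have "e \<le> U y"
      using scott_open_upper[OF S[OF order.trans[OF e d] U(1)] U(2) order.trans[OF e l]] .
    with U(1) show "e \<le> (\<^bold>\<exists>U. S U \<^bold>\<and> U y)" by (intro forces_hExI[of _ _ U]) simp
  qed
next
  fix d T u
  assume d: "d \<le> c" and T: "d \<le> directed D T" "d \<le> is_supremum D T u"
    and u: "d \<le> (\<^bold>\<exists>U. S U \<^bold>\<and> U u)"
  let ?g = "\<^bold>\<exists>s. T s \<^bold>\<and> (\<^bold>\<exists>U. S U \<^bold>\<and> U s)"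
  show "d \<le> ?g"
  proof (rule forces_hExE[OF u])
    fix e U assume e: "e \<le> d" and "e \<le> (S U \<^bold>\<and> U u)"
    then have U: "e \<le> S U" "e \<le> U u" by simp_all
    have "e \<le> (\<^bold>\<exists>s. T s \<^bold>\<and> U s)"
      using scott_open_directed[OF S[OF order.trans[OF e d] U(1)]
        order.trans[OF e T(1)] order.trans[OF e T(2)] U(2)] .
    then show "e \<le> ?g"
    proof (rule forces_hExE)
      fix f s assume f: "f \<le> e" and s: "f \<le> (T s \<^bold>\<and> U s)"
      have "f \<le> (S U \<^bold>\<and> U s)" using s order.trans[OF f U(1)] by simp
      then have "f \<le> (\<^bold>\<exists>U. S U \<^bold>\<and> U s)" by (intro forces_hExI[of _ _ U])
      with s show "f \<le> ?g" by (intro forces_hExI[of _ _ s]) simp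
    qed
  qed
qed

text \<open>The binary union is the union of the family consisting of the two names \<open>U\<close>
  and \<open>V\<close>, with membership of truth value \<open>top\<close> or
  \<open>bot\<close>.\<close>

lemma scott_open_Un:
  assumes P: "c \<le> poset D" and U: "c \<le> scott_open D U" and V: "c \<le> scott_open D V"
  shows "c \<le> scott_open D (\<lambda>x. U x \<^bold>\<or> V x)"
proof -
  have "c \<le> scott_open D (\<lambda>x. \<^bold>\<exists>W. (if W = U \<or> W = V then top else bot) \<^bold>\<and> W x)"
  proof (rule scott_open_Union[OF P])
    fix d W assume d: "d \<le> c" and W: "d \<le> (if W = U \<or> W = V then top else bot)"
    show "d \<le> scott_open D W"
    proof (cases "W = U \<or> W = V")
      case True
      then show ?thesis using order.trans[OF d U] order.trans[OF d V] by blast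
    next
      case False
      \<comment> \<open>Membership of any other name is forced only at the stage \<open>bot\<close>,
        which forces everything.\<close>
      with W have "d = bot" by (simp add: bot_unique)
      then show ?thesis by simp
    qed
  qed
  also have "(\<lambda>x. \<^bold>\<exists>W. (if W = U \<or> W = V then top else bot) \<^bold>\<and> W x) = (\<lambda>x. U x \<^bold>\<or> V x)"
  proof (intro ext antisym)
    fix x
    show "(\<^bold>\<exists>W. (if W = U \<or> W = V then top else bot) \<^bold>\<and> W x) \<le> (U x \<^bold>\<or> V x)"
      by (rule SUP_least) auto
    show "(U x \<^bold>\<or> V x) \<le> (\<^bold>\<exists>W. (if W = U \<or> W = V then top else bot) \<^bold>\<and> W x)"
      by (intro sup_least forces_hExI[of "U x" _ U] forces_hExI[of "V x" _ V]) simp_all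
  qed
  finally show ?thesis .
qed

section \<open>The poset of Scott opens under inclusion\<close>

lemma carr_scott_opens: "c \<le> carr (scott_opens D) U \<longleftrightarrow> c \<le> scott_open D U"
  by (simp add: carr_def scott_opens_def forces_iff)

lemma leq_scott_opens:
  "c \<le> leq (scott_opens D) U V \<longleftrightarrow>
    c \<le> scott_open D U \<and> c \<le> scott_open D V \<and> (\<forall>d\<le>c. \<forall>x. d \<le> U x \<longrightarrow> d \<le> V x)"
  by (auto simp: scott_opens_def forces_iff)

lemma leq_scott_opensD: "c \<le> leq (scott_opens D) U V \<Longrightarrow> c \<le> U x \<Longrightarrow> c \<le> V x"
  unfolding leq_scott_opens by blast

text \<open>The union of \<open>S\<close> is itself a Scott open upper bound of \<open>S\<close>, so
  the supremum \<open>V\<close> is included in it.\<close>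

lemma is_supremum_scott_opensD:
  assumes P: "c \<le> poset D" and S: "c \<le> subset_of (scott_opens D) S"
    and u: "c \<le> is_supremum (scott_opens D) S V" and x: "c \<le> V x"
  shows "c \<le> (\<^bold>\<exists>U. S U \<^bold>\<and> U x)"
proof -
  have op: "d \<le> scott_open D U" if "d \<le> c" "d \<le> S U" for d U
    using subset_of_carr[OF order.trans[OF that(1) S], OF that(2)] by (simp only: carr_scott_opens)
  have un: "c \<le> scott_open D (\<lambda>x. \<^bold>\<exists>U. S U \<^bold>\<and> U x)" by (rule scott_open_Union[OF P op])
  have "c \<le> leq (scott_opens D) V (\<lambda>x. \<^bold>\<exists>U. S U \<^bold>\<and> U x)"
  proof (rule is_supremum_least[OF u])
    show "c \<le> carr (scott_opens D) (\<lambda>x. \<^bold>\<exists>U. S U \<^bold>\<and> U x)" using un by (simp add: carr_scott_opens)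
  next
    fix d U assume d: "d \<le> c" and U: "d \<le> S U"
    have "e \<le> (\<^bold>\<exists>U. S U \<^bold>\<and> U x)" if "e \<le> d" "e \<le> U x" for e x
      by (rule forces_hExI[of _ _ U]) (use that order.trans[OF that(1) U] in simp)
    then show "d \<le> leq (scott_opens D) U (\<lambda>x. \<^bold>\<exists>U. S U \<^bold>\<and> U x)"
      unfolding leq_scott_opens using op[OF d U] order.trans[OF d un] by blast
  qed
  then show ?thesis using x by (rule leq_scott_opensD)
qed

text \<open>A directed family whose supremum includes the set of elements way above \<open>y\<close>
  covers \<open>z\<close>. The member that contains \<open>z\<close> is an upper set, so it contains
  everything way above \<open>z\<close>.\<close>

lemma way_below_scott_opens:
  assumes D: "c \<le> continuous_dcpo D" and yz: "c \<le> way_below D y z"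
  shows "c \<le> way_below (scott_opens D) (way_below D z) (way_below D y)"
proof (rule way_belowI)
  show "c \<le> carr (scott_opens D) (way_below D z)" "c \<le> carr (scott_opens D) (way_below D y)"
    using scott_open_way_below[OF D] by (simp_all add: carr_scott_opens)
next
  fix d S V
  assume d: "d \<le> c" and S: "d \<le> directed (scott_opens D) S" "d \<le> is_supremum (scott_opens D) S V"
    and l: "d \<le> leq (scott_opens D) (way_below D y) V"
  have Dd: "d \<le> continuous_dcpo D" using D d by simp
  have sub: "d \<le> subset_of (scott_opens D) S" using S(1) by (rule directed_subset)
  have "d \<le> V z" using l order.trans[OF d yz] by (rule leq_scott_opensD)
  then have "d \<le> (\<^bold>\<exists>U. S U \<^bold>\<and> U z)"
    by (rule is_supremum_scott_opensD[OF continuous_dcpo_poset[OF Dd] sub S(2)])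
  then show "d \<le> (\<^bold>\<exists>U. S U \<^bold>\<and> leq (scott_opens D) (way_below D z) U)"
  proof (rule forces_hExE)
    fix e U assume e: "e \<le> d" and "e \<le> (S U \<^bold>\<and> U z)"
    then have U: "e \<le> S U" "e \<le> U z" by simp_all
    have De: "e \<le> continuous_dcpo D" using Dd e by simp
    have op: "e \<le> scott_open D U"
      using subset_of_carr[OF order.trans[OF e sub], OF U(1)] by (simp add: carr_scott_opens)
    have "f \<le> U w" if f: "f \<le> e" and w: "f \<le> way_below D z w" for f w
      using scott_open_upper[OF order.trans[OF f op] order.trans[OF f U(2)]
        way_below_leq[OF order.trans[OF f De] w]] .
    then have "e \<le> leq (scott_opens D) (way_below D z) U"
      unfolding leq_scott_opens using op scott_open_way_below[OF De] by blast
    with U(1) show "e \<le> (\<^bold>\<exists>U. S U \<^bold>\<and> leq (scott_opens D) (way_below D z) U)"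
      by (intro forces_hExI[of _ _ U]) simp
  qed
qed

section \<open>Sharpness and locatedness\<close>

lemma sharpD:
  assumes x: "c \<le> sharp D x" and yz: "c \<le> way_below D y z"
  shows "c \<le> (way_below D y x \<^bold>\<or> \<^bold>\<not> leq D z x)"
proof -
  have "c \<le> (way_below D y z \<^bold>\<longrightarrow> way_below D y x \<^bold>\<or> \<^bold>\<not> leq D z x)"
    using x unfolding sharp_def forces_hAll_iff by blast
  then show ?thesis using yz by (rule forces_mp)
qed

lemma sharpI:
  assumes "\<And>d y z. d \<le> c \<Longrightarrow> d \<le> way_below D y z
    \<Longrightarrow> d \<le> (way_below D y x \<^bold>\<or> \<^bold>\<not> leq D z x)"
  shows "c \<le> sharp D x"
  unfolding sharp_def forces_hAll_iff forces_himp_iff[of c] using assms by blast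

lemma locatedD:
  assumes V: "c \<le> located P V" and st: "c \<le> way_below P s t"
  shows "c \<le> (V t \<^bold>\<or> \<^bold>\<not> V s)"
proof -
  have "c \<le> (way_below P s t \<^bold>\<longrightarrow> V t \<^bold>\<or> \<^bold>\<not> V s)"
    using V unfolding located_def forces_hAll_iff by blast
  then show ?thesis using st by (rule forces_mp)
qed

lemma locatedI:
  assumes "\<And>d s t. d \<le> c \<Longrightarrow> d \<le> way_below P s t \<Longrightarrow> d \<le> (V t \<^bold>\<or> \<^bold>\<not> V s)"
  shows "c \<le> located P V"
  unfolding located_def forces_hAll_iff forces_himp_iff[of c] using assms by blast

lemma hnegI: "(\<And>d. d \<le> c \<Longrightarrow> d \<le> p \<Longrightarrow> d \<le> bot) \<Longrightarrow> c \<le> (\<^bold>\<not> p)"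
  for c :: "'h::complete_heyting_algebra"
  unfolding forces_himp_iff by blast

section \<open>From sharpness to locatedness\<close>

lemma sharp_imp_located:
  assumes D: "c \<le> continuous_dcpo D" and x: "c \<le> sharp D x"
  shows "c \<le> located (scott_opens D) (open_nbhds D x)"
proof -
  have "d \<le> (open_nbhds D x V \<^bold>\<or> \<^bold>\<not> open_nbhds D x U)"
    if d: "d \<le> c" and UV: "d \<le> way_below (scott_opens D) U V" for d U V
  proof -
    \<comment> \<open>Membership in \<open>S\<close> carries the decision to be made. If a member
      includes \<open>U\<close>, its decision carries over to \<open>U\<close>, because not
      containing \<open>x\<close> passes to smaller sets.\<close>
    define S where "S W = (leq (scott_opens D) W V \<^bold>\<and> (V x \<^bold>\<or> \<^bold>\<not> W x))" for W
    have Dd: "d \<le> continuous_dcpo D" and xd: "d \<le> sharp D x" using D x d by simp_all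
    have V: "d \<le> scott_open D V" using way_below_carr(2)[OF UV] by (simp add: carr_scott_opens)
    have P: "d \<le> poset D" using Dd by (rule continuous_dcpo_poset)
    have sub: "d \<le> subset_of (scott_opens D) S"
    proof (rule subset_ofI)
      show "e \<le> carr (scott_opens D) W" if "e \<le> S W" for e W
        using that by (simp add: S_def carr_scott_opens leq_scott_opens)
    next
      fix e W W' assume e: "e \<le> d" and W: "e \<le> S W" and "e \<le> equ (scott_opens D) W W'"
      then have W': "e \<le> scott_open D W'" and eq: "\<And>f z. f \<le> e \<Longrightarrow> f \<le> W z \<longleftrightarrow> f \<le> W' z"
        by (auto simp: scott_opens_def forces_iff)
      have l: "e \<le> leq (scott_opens D) W' V"
        using W W' eq by (auto simp: S_def leq_scott_opens)
      have "e \<le> (V x \<^bold>\<or> \<^bold>\<not> W x)" using W by (simp add: S_def)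
      then have "e \<le> (V x \<^bold>\<or> \<^bold>\<not> W' x)"
      proof (rule forces_hdisjE)
        fix f assume "f \<le> e" "f \<le> (\<^bold>\<not> W x)"
        \<comment> \<open>Equal opens have the same elements at every stage below \<open>e\<close>,
          as the negation requires.\<close>
        then have "f \<le> (\<^bold>\<not> W' x)" using eq unfolding forces_himp_iff by (meson order.trans)
        then show "f \<le> (V x \<^bold>\<or> \<^bold>\<not> W' x)" by (rule le_supI2)
      qed (rule le_supI1)
      with l show "e \<le> S W'" by (simp add: S_def)
    qed
    have dir: "d \<le> directed (scott_opens D) S"
    proof (rule directedI[OF sub])
      \<comment> \<open>The empty open is a member because the negation of \<open>bot\<close> is
        forced at every stage; this inhabits \<open>S\<close> without deciding
        \<open>V x\<close>.\<close>
      have "d \<le> S (\<lambda>z. bot)"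
        using V scott_open_empty[OF P]
        by (auto simp: S_def leq_scott_opens intro!: le_supI2 hnegI intro: order.trans[OF _ bot_least])
      then show "d \<le> (\<^bold>\<exists>W. S W)" by (intro forces_hExI[of _ S])
    next
      fix e W1 W2 assume e: "e \<le> d" and W1: "e \<le> S W1" and W2: "e \<le> S W2"
      let ?W = "\<lambda>z. W1 z \<^bold>\<or> W2 z"
      have op: "e \<le> scott_open D W1" "e \<le> scott_open D W2" "e \<le> scott_open D V"
        using W1 W2 by (simp_all add: S_def leq_scott_opens)
      have opW: "e \<le> scott_open D ?W" using scott_open_Un[OF order.trans[OF e P] op(1,2)] .
      have l12: "e \<le> leq (scott_opens D) W1 V" "e \<le> leq (scott_opens D) W2 V"
        using W1 W2 by (simp_all add: S_def)
      have "f \<le> V z" if f: "f \<le> e" and "f \<le> ?W z" for f z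
        by (rule forces_hdisjE[OF that(2)]; erule leq_scott_opensD[rotated];
          rule order.trans[OF order.trans[OF _ f]]; (assumption | rule l12))
      then have l: "e \<le> leq (scott_opens D) ?W V" using op opW by (auto simp: leq_scott_opens)
      have "e \<le> (V x \<^bold>\<or> \<^bold>\<not> W1 x)" using W1 by (simp add: S_def)
      \<comment> \<open>If either decision yields \<open>V x\<close>, so does the decision for the
        union. Otherwise both negations are available and together refute membership in the
        union.\<close>
      then have "e \<le> (V x \<^bold>\<or> \<^bold>\<not> ?W x)"
      proof (rule forces_hdisjE)
        fix f assume f: "f \<le> e" and n1: "f \<le> (\<^bold>\<not> W1 x)"
        have "f \<le> (V x \<^bold>\<or> \<^bold>\<not> W2 x)" using order.trans[OF f W2] by (simp add: S_def)
        then show "f \<le> (V x \<^bold>\<or> \<^bold>\<not> ?W x)"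
        proof (rule forces_hdisjE)
          fix g assume g: "g \<le> f" and n2: "g \<le> (\<^bold>\<not> W2 x)"
          have "g \<le> (\<^bold>\<not> ?W x)"
          proof (rule hnegI)
            fix h assume h: "h \<le> g" and W: "h \<le> ?W x"
            show "h \<le> bot"
              by (rule forces_hdisjE[OF W])
                (use forces_mp[OF order.trans[OF _ order.trans[OF h order.trans[OF g n1]]]]
                  forces_mp[OF order.trans[OF _ order.trans[OF h n2]]] in blast)+
          qed
          then show "g \<le> (V x \<^bold>\<or> \<^bold>\<not> ?W x)" by (rule le_supI2)
        qed (rule le_supI1)
      qed (rule le_supI1)
      with l have "e \<le> S ?W" by (simp add: S_def)
      moreover have "e \<le> leq (scott_opens D) W1 ?W" "e \<le> leq (scott_opens D) W2 ?W"
        using op opW by (auto simp: leq_scott_opens intro: le_supI1 le_supI2)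
      ultimately show "e \<le> (\<^bold>\<exists>W. S W \<^bold>\<and> leq (scott_opens D) W1 W \<^bold>\<and> leq (scott_opens D) W2 W)"
        by (intro forces_hExI[of _ _ ?W]) simp
    qed
    have basic: "e \<le> S (way_below D z)" if e: "e \<le> d" and z: "e \<le> V z" for e z
    proof -
      have De: "e \<le> continuous_dcpo D" and Ve: "e \<le> scott_open D V" using Dd V e by simp_all
      have "f \<le> V w" if f: "f \<le> e" and w: "f \<le> way_below D z w" for f w
        using scott_open_upper[OF order.trans[OF f Ve] order.trans[OF f z]
          way_below_leq[OF order.trans[OF f De] w]] .
      then have l: "e \<le> leq (scott_opens D) (way_below D z) V"
        using Ve scott_open_way_below[OF De] unfolding leq_scott_opens by blast
      have zc: "e \<le> carr D z" using Ve z by (rule scott_open_carr)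
      \<comment> \<open>Openness of \<open>V\<close>, applied to the approximants of
        \<open>z\<close>, yields a \<open>y\<close> inside \<open>V\<close>. Choosing
        \<open>y\<close> in \<open>V\<close> makes the sharpness alternative
        \<open>y \<ll> x\<close> give \<open>V x\<close>.\<close>
      have "e \<le> (\<^bold>\<exists>y. way_below D y z \<^bold>\<and> V y)"
        using scott_open_directed[OF Ve directed_way_below[OF De zc] is_supremum_way_below[OF De zc] z] .
      then have "e \<le> (V x \<^bold>\<or> \<^bold>\<not> way_below D z x)"
      proof (rule forces_hExE)
        fix f y assume f: "f \<le> e" and "f \<le> (way_below D y z \<^bold>\<and> V y)"
        then have y: "f \<le> way_below D y z" "f \<le> V y" by simp_all
        have Df: "f \<le> continuous_dcpo D" and Vf: "f \<le> scott_open D V" using De Ve f by simp_all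
        have "f \<le> (way_below D y x \<^bold>\<or> \<^bold>\<not> leq D z x)"
          using sharpD[OF order.trans[OF f order.trans[OF e xd]] y(1)] .
        then show "f \<le> (V x \<^bold>\<or> \<^bold>\<not> way_below D z x)"
        proof (rule forces_hdisjE)
          fix g assume g: "g \<le> f" and yx: "g \<le> way_below D y x"
          have "g \<le> V x"
            using scott_open_upper[OF order.trans[OF g Vf] order.trans[OF g y(2)]
              way_below_leq[OF order.trans[OF g Df] yx]] .
          then show "g \<le> (V x \<^bold>\<or> \<^bold>\<not> way_below D z x)" by (rule le_supI1)
        next
          fix g assume g: "g \<le> f" and n: "g \<le> (\<^bold>\<not> leq D z x)"
          have "g \<le> (\<^bold>\<not> way_below D z x)"
          proof (rule hnegI)
            fix h assume h: "h \<le> g" and zx: "h \<le> way_below D z x"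
            show "h \<le> bot"
              using forces_mp[OF order.trans[OF h n] way_below_leq[OF order.trans[OF h order.trans[OF g Df]] zx]] .
          qed
          then show "g \<le> (V x \<^bold>\<or> \<^bold>\<not> way_below D z x)" by (rule le_supI2)
        qed
      qed
      with l show ?thesis by (simp add: S_def)
    qed
    have sup: "d \<le> is_supremum (scott_opens D) S V"
    proof (rule is_supremumI)
      show "d \<le> carr (scott_opens D) V" using V by (simp add: carr_scott_opens)
      show "e \<le> leq (scott_opens D) W V" if "e \<le> S W" for e W using that by (simp add: S_def)
    next
      fix e T assume e: "e \<le> d" and T: "e \<le> carr (scott_opens D) T"
        and ub: "\<And>f W. f \<le> e \<Longrightarrow> f \<le> S W \<Longrightarrow> f \<le> leq (scott_opens D) W T"
      have "f \<le> T z" if f: "f \<le> e" and z: "f \<le> V z" for f z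
      proof -
        have Df: "f \<le> continuous_dcpo D" and Vf: "f \<le> scott_open D V" using Dd V e f by simp_all
        have zc: "f \<le> carr D z" using Vf z by (rule scott_open_carr)
        \<comment> \<open>Again \<open>z\<close> has an approximant \<open>y\<close> in
          \<open>V\<close>. The set of elements way above \<open>y\<close> belongs to
          \<open>S\<close> by \<open>basic\<close> and contains \<open>z\<close>, so
          \<open>z\<close> lies in the upper bound \<open>T\<close>.\<close>
        have "f \<le> (\<^bold>\<exists>y. way_below D y z \<^bold>\<and> V y)"
          using scott_open_directed[OF Vf directed_way_below[OF Df zc] is_supremum_way_below[OF Df zc] z] .
        then show ?thesis
        proof (rule forces_hExE)
          fix g y assume g: "g \<le> f" and "g \<le> (way_below D y z \<^bold>\<and> V y)"
          then have y: "g \<le> way_below D y z" "g \<le> V y" by simp_all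
          have "g \<le> S (way_below D y)"
            using basic[OF order.trans[OF g order.trans[OF f e]] y(2)] .
          then have "g \<le> leq (scott_opens D) (way_below D y) T" by (rule ub[OF order.trans[OF g f]])
          then show "g \<le> T z" using y(1) by (rule leq_scott_opensD)
        qed
      qed
      moreover have "e \<le> scott_open D T" using T by (simp add: carr_scott_opens)
      ultimately show "e \<le> leq (scott_opens D) V T"
        using order.trans[OF e V] unfolding leq_scott_opens by blast
    qed
    have "d \<le> leq (scott_opens D) V V" using V by (simp add: leq_scott_opens)
    \<comment> \<open>The hypothesis on \<open>U\<close> and \<open>V\<close> is applied to
      \<open>S\<close>, whose supremum is \<open>V\<close> itself.\<close>
    then have "d \<le> (\<^bold>\<exists>W. S W \<^bold>\<and> leq (scott_opens D) U W)" by (rule way_belowD[OF UV dir sup])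
    then show ?thesis
    proof (rule forces_hExE)
      fix e W assume e: "e \<le> d" and "e \<le> (S W \<^bold>\<and> leq (scott_opens D) U W)"
      then have W: "e \<le> (V x \<^bold>\<or> \<^bold>\<not> W x)" and UW: "e \<le> leq (scott_opens D) U W"
        by (simp_all add: S_def)
      show "e \<le> (open_nbhds D x V \<^bold>\<or> \<^bold>\<not> open_nbhds D x U)"
      proof (rule forces_hdisjE[OF W])
        fix f assume f: "f \<le> e" and x: "f \<le> V x"
        show "f \<le> (open_nbhds D x V \<^bold>\<or> \<^bold>\<not> open_nbhds D x U)"
          using order.trans[OF f order.trans[OF e V]] x by (intro le_supI1) (simp add: open_nbhds_def)
      next
        fix f assume f: "f \<le> e" and n: "f \<le> (\<^bold>\<not> W x)"
        have "f \<le> (\<^bold>\<not> open_nbhds D x U)"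
        proof (rule hnegI)
          fix g assume g: "g \<le> f" and "g \<le> open_nbhds D x U"
          then have "g \<le> U x" by (simp add: open_nbhds_def)
          then have "g \<le> W x" by (rule leq_scott_opensD[OF order.trans[OF g order.trans[OF f UW]]])
          then show "g \<le> bot" by (rule forces_mp[OF order.trans[OF g n]])
        qed
        then show "f \<le> (open_nbhds D x V \<^bold>\<or> \<^bold>\<not> open_nbhds D x U)" by (rule le_supI2)
      qed
    qed
  qed
  then show ?thesis by (rule locatedI)
qed

section \<open>From locatedness to sharpness\<close>

lemma located_imp_sharp:
  assumes D: "c \<le> continuous_dcpo D" and loc: "c \<le> located (scott_opens D) (open_nbhds D x)"
  shows "c \<le> sharp D x"
proof -
  have "d \<le> (way_below D y x \<^bold>\<or> \<^bold>\<not> leq D z x)"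
    if d: "d \<le> c" and yz: "d \<le> way_below D y z" for d y z
  \<comment> \<open>Locatedness for the opens above \<open>y\<close> and \<open>z\<close> could only
    refute \<open>z \<ll> x\<close>, whereas sharpness must refute \<open>z \<sqsubseteq> x\<close>.
    With \<open>w \<ll> z\<close> interposed, \<open>z \<sqsubseteq> x\<close> implies
    \<open>w \<ll> x\<close>, so refuting the latter suffices.\<close>
  proof (rule forces_hExE[OF way_below_interpolate[OF order.trans[OF d D] yz]])
    fix e w assume e: "e \<le> d" and "e \<le> (way_below D y w \<^bold>\<and> way_below D w z)"
    then have w: "e \<le> way_below D y w" "e \<le> way_below D w z" by simp_all
    have De: "e \<le> continuous_dcpo D" using D d e by simp
    have "e \<le> (open_nbhds D x (way_below D y) \<^bold>\<or> \<^bold>\<not> open_nbhds D x (way_below D w))"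
      using locatedD[OF order.trans[OF e order.trans[OF d loc]] way_below_scott_opens[OF De w(1)]] .
    then show "e \<le> (way_below D y x \<^bold>\<or> \<^bold>\<not> leq D z x)"
    proof (rule forces_hdisjE)
      fix f assume "f \<le> open_nbhds D x (way_below D y)"
      then show "f \<le> (way_below D y x \<^bold>\<or> \<^bold>\<not> leq D z x)"
        by (intro le_supI1) (simp add: open_nbhds_def)
    next
      fix f assume f: "f \<le> e" and n: "f \<le> (\<^bold>\<not> open_nbhds D x (way_below D w))"
      have "f \<le> (\<^bold>\<not> leq D z x)"
      proof (rule hnegI)
        fix g assume g: "g \<le> f" and zx: "g \<le> leq D z x"
        have Dg: "g \<le> continuous_dcpo D" using De f g by simp
        have "g \<le> way_below D w x"
          using way_below_leq_trans[OF Dg order.trans[OF g order.trans[OF f w(2)]] zx] .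
        then have "g \<le> open_nbhds D x (way_below D w)"
          using scott_open_way_below[OF Dg] by (simp add: open_nbhds_def)
        then show "g \<le> bot" by (rule forces_mp[OF order.trans[OF g n]])
      qed
      then show "f \<le> (way_below D y x \<^bold>\<or> \<^bold>\<not> leq D z x)" by (rule le_supI2)
    qed
  qed
  then show ?thesis by (rule sharpI)
qed

theorem proposition5p13:
  fixes D :: "('a, 'h::complete_heyting_algebra) hposet"
  shows "\<Turnstile> continuous_dcpo D \<^bold>\<longrightarrow>
    (\<^bold>\<forall>x. carr D x \<^bold>\<longrightarrow> (sharp D x \<^bold>\<longleftrightarrow> located (scott_opens D) (open_nbhds D x)))"
  unfolding holds_himp_iff
proof (unfold forces_hAll_iff, intro allI)
  fix x
  have "c \<le> (sharp D x \<^bold>\<longleftrightarrow> located (scott_opens D) (open_nbhds D x))"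
    if D: "c \<le> continuous_dcpo D" for c
  proof (rule inf_greatest)
    show "c \<le> (sharp D x \<^bold>\<longrightarrow> located (scott_opens D) (open_nbhds D x))"
      using sharp_imp_located[OF order.trans[OF _ D]] by (subst forces_himp_iff) blast
    show "c \<le> (located (scott_opens D) (open_nbhds D x) \<^bold>\<longrightarrow> sharp D x)"
      using located_imp_sharp[OF order.trans[OF _ D]] by (subst forces_himp_iff) blast
  qed
  then show "continuous_dcpo D \<le>
      (carr D x \<^bold>\<longrightarrow> (sharp D x \<^bold>\<longleftrightarrow> located (scott_opens D) (open_nbhds D x)))"
    by (subst forces_himp_iff) blast
qed

end
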